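(* Let $\mathcal{L}$ be the set of all $n\in\mathbb{N}$ for which there exists a non-degenerate integer linear recurrence sequence $\mathbf{u}$ such that $u_n=0$ and $n\ge\exp\exp(10H_{\mathbf{u}}\log H_{\mathbf{u}})$, where $H_{\mathbf{u}}$ is the height of $\mathbf{u}$. Then $\mathcal{L}$ has null density. In fact, writing $\mathcal{L}(X)=\mathcal{L}\cap[1,X]$, for every constant $B>0$ one has $$\#\mathcal{L}(X)=O\left(\frac{X}{(\log X)^B}\right)$$ as $X\to\infty$ (with implied constant allowed to depend on $B$).
   Context: Logarithms and exponentials are natural; $\exp\exp(x)=e^{e^x}$. An (integer) linear recurrence sequence (LRS) $\mathbf{u}=\langle u_n\rangle_{n=0}^\infty$ is a sequence of integers satisfying $u_{n+k}=a_1u_{n+k-1}+\cdots+a_ku_n$ for all $n\ge 0$, where $k\ge 1$, $a_1,\ldots,a_k\in\mathbb{Z}$ and $a_k\neq 0$; it is given by the data $k,a_1,\ldots,a_k,u_0,\ldots,u_{k-1}$. It is non-degenerate if it is not identically zero and, in its minimal recurrence (the one of least order), no quotient of two distinct roots of the characteristic polynomial is a root of unity. Its height is $H_{\mathbf{u}}:=\max\{k,|a_1|,\ldots,|a_k|,|u_0|,\ldots,|u_{k-1}|\}$. No lower bound on the height is imposed in the definition of $\mathcal{L}$. Null density means $\lim_{X\to\infty}\#(\mathcal{L}\cap[1,X])/X=0$. *)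

theory Defs
  imports
    Complex_Main
    "HOL-Library.Landau_Symbols"
    "HOL-Computational_Algebra.Polynomial"
begin

text \<open>
  The data of a linear recurrence sequence are an order \<open>k\<close>, the coefficients
  \<open>a 1, \<dots>, a k\<close> and the sequence \<open>u\<close> itself; values of \<open>a\<close> outside \<open>{1..k}\<close> are irrelevant.
\<close>

definition lrs :: "nat \<Rightarrow> (nat \<Rightarrow> int) \<Rightarrow> (nat \<Rightarrow> int) \<Rightarrow> bool" where
  "lrs k a u \<longleftrightarrow> 1 \<le> k \<and> a k \<noteq> 0 \<and> (\<forall>n. u (n + k) = (\<Sum>i=1..k. a i * u (n + k - i)))"

definition height :: "nat \<Rightarrow> (nat \<Rightarrow> int) \<Rightarrow> (nat \<Rightarrow> int) \<Rightarrow> int" where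
  "height k a u = Max ({int k} \<union> (\<lambda>i. \<bar>a i\<bar>) ` {1..k} \<union> (\<lambda>i. \<bar>u i\<bar>) ` {..<k})"

definition char_poly_lrs :: "nat \<Rightarrow> (nat \<Rightarrow> int) \<Rightarrow> complex poly" where
  "char_poly_lrs k a = monom 1 k - (\<Sum>i=1..k. monom (of_int (a i)) (k - i))"

definition minimal_recurrence :: "nat \<Rightarrow> (nat \<Rightarrow> int) \<Rightarrow> (nat \<Rightarrow> int) \<Rightarrow> bool" where
  "minimal_recurrence k a u \<longleftrightarrow> lrs k a u \<and> (\<forall>k' a'. lrs k' a' u \<longrightarrow> k \<le> k')"

definition root_of_unity :: "complex \<Rightarrow> bool" where
  "root_of_unity z \<longleftrightarrow> (\<exists>m::nat. m \<ge> 1 \<and> z ^ m = 1)"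

text \<open>
  For a sequence that is not identically zero, the coefficients \<open>a 1, \<dots>, a k\<close> of a recurrence of
  least order are unique, and by Gauss's lemma it does not matter whether least order is meant over
  the integers or over the rationals.  The order \<open>k\<close> and coefficients \<open>a\<close> below need not be those
  by which \<open>u\<close> is given when its height is computed.
\<close>

definition nondegenerate :: "(nat \<Rightarrow> int) \<Rightarrow> bool" where
  "nondegenerate u \<longleftrightarrow> (\<exists>n. u n \<noteq> 0) \<and>
     (\<exists>k a. minimal_recurrence k a u \<and>
       (\<forall>\<alpha> \<beta>. poly (char_poly_lrs k a) \<alpha> = 0 \<and> poly (char_poly_lrs k a) \<beta> = 0 \<and> \<alpha> \<noteq> \<beta>
          \<longrightarrow> \<not> root_of_unity (\<alpha> / \<beta>)))"

definition large_zeros :: "nat set" where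
  "large_zeros = {n. \<exists>k a u. lrs k a u \<and> nondegenerate u \<and> u n = 0 \<and>
     real n \<ge> exp (exp (10 * real_of_int (height k a u) * ln (real_of_int (height k a u))))}"

definition count_upto :: "nat set \<Rightarrow> real \<Rightarrow> nat" where
  "count_upto A X = card {n \<in> A. 1 \<le> real n \<and> real n \<le> X}"

definition null_density :: "nat set \<Rightarrow> bool" where
  "null_density A \<longleftrightarrow> ((\<lambda>X. real (count_upto A X) / X) \<longlongrightarrow> 0) at_top"

end

theory Submission
  imports
    Defs
    "HOL-Computational_Algebra.Fundamental_Theorem_Algebra"
    "HOL-Computational_Algebra.Primes"
    "HOL-Real_Asymp.Real_Asymp"
begin

text \<open>
  A large zero at most \<open>X\<close> belongs to a sequence of height at most \<open>T = ln ln X\<close>, and there are only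
  \<open>exp (O (T ln T))\<close> such sequences, so it suffices that each of them has \<open>exp (O (T ln T))\<close> zeros.
  Let \<open>f\<close> be the characteristic polynomial and \<open>p\<close> a prime divisor of \<open>\<bar>a k\<bar> + 1\<close>.  By pigeonhole
  \<open>x ^ N \<equiv> 1\<close> modulo \<open>(f, p\<^sup>2)\<close> for some \<open>N \<le> p ^ (2 k)\<close>, so that
  \<open>u (r + N t) = (\<Sum>j\<le>t. (t choose j) p ^ (2 j) b j)\<close> with integers \<open>b j\<close>.  As \<open>p ^ j / j!\<close> is a
  \<open>p\<close>-adic integer, dividing out roots as in Strassmann's theorem shows that \<open>L\<close> zeros on the
  progression force \<open>p ^ L\<close> to divide every term of it.  Nondegeneracy gives a nonzero term with
  \<open>t < k\<close>, whose size bounds \<open>L\<close>.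
\<close>

subsection \<open>Polynomials in the shift operator\<close>

text \<open>Sequences become a module over the polynomial ring, with x acting as the shift. Through
  \<open>act_mult\<close>, factoring a polynomial means composing operators.\<close>

definition act :: "'a::comm_ring_1 poly \<Rightarrow> (nat \<Rightarrow> 'a) \<Rightarrow> nat \<Rightarrow> 'a" where
  "act P u n = (\<Sum>i\<le>degree P. coeff P i * u (n + i))"

lemma act_eq_sum:
  assumes "degree P \<le> d"
  shows "act P u n = (\<Sum>i\<le>d. coeff P i * u (n + i))"
  unfolding act_def
  by (rule sum.mono_neutral_left) (use assms in \<open>auto simp: coeff_eq_0\<close>)

lemma act_0 [simp]: "act 0 u = (\<lambda>_. 0)"
  by (simp add: act_def fun_eq_iff)

lemma act_add: "act (P + Q) u n = act P u n + act Q u n"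
  using degree_add_le_max[of P Q]
  by (simp add: act_eq_sum[where d = "max (degree P) (degree Q)"] algebra_simps sum.distrib)

lemma act_monom [simp]: "act (monom c m) u n = c * u (n + m)"
proof -
  have "act (monom c m) u n = (\<Sum>i\<le>m. if i = m then c * u (n + m) else 0)"
    unfolding act_eq_sum[OF degree_monom_le] by (intro sum.cong) auto
  then show ?thesis by simp
qed

lemma act_smult: "act (smult c P) u n = c * act P u n"
proof -
  have "act (smult c P) u n = (\<Sum>i\<le>degree P. coeff (smult c P) i * u (n + i))"
    by (rule act_eq_sum) (rule degree_smult_le)
  then show ?thesis by (simp add: act_def sum_distrib_left mult.assoc)
qed

lemma act_minus: "act (- P) u n = - act P u n"
  using act_smult[of "-1" P] by simp

lemma act_diff: "act (P - Q) u n = act P u n - act Q u n"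
  using act_add[of P "- Q"] by (simp add: act_minus)

lemma act_sum: "act (sum P A) u n = (\<Sum>i\<in>A. act (P i) u n)"
  by (induction A rule: infinite_finite_induct) (simp_all add: act_add)

lemma act_pCons: "act (pCons c P) u n = c * u n + act P u (Suc n)"
proof -
  have "act (pCons c P) u n = (\<Sum>i\<le>Suc (degree P). coeff (pCons c P) i * u (n + i))"
    by (rule act_eq_sum) (rule degree_pCons_le)
  then show ?thesis
    by (simp add: sum.atMost_Suc_shift act_def del: sum.atMost_Suc)
qed

lemma act_const_0 [simp]: "act P (\<lambda>_. 0) = (\<lambda>_. 0)"
  by (simp add: act_def fun_eq_iff)

lemma act_mult: "act (P * Q) u = act P (act Q u)"
proof (rule ext)
  show "act (P * Q) u n = act P (act Q u) n" for n
    by (induction P arbitrary: n) (simp_all add: act_add act_smult act_pCons mult_pCons_left)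
qed

lemma act_1 [simp]: "act 1 u = u"
  by (simp add: fun_eq_iff act_def)

text \<open>The ring is left general because both readings occur: over the complex numbers for the
  roots, over the integers for congruences.\<close>

definition rec_poly :: "nat \<Rightarrow> (nat \<Rightarrow> 'a::comm_ring_1) \<Rightarrow> 'a poly" where
  "rec_poly k a = monom 1 k - (\<Sum>i=1..k. monom (a i) (k - i))"

lemma coeff_rec_poly:
  assumes "k \<ge> 1"
  shows "coeff (rec_poly k a) k = 1" "j > k \<Longrightarrow> coeff (rec_poly k a) j = 0"
    "coeff (rec_poly k a) 0 = - a k"
proof -
  have coeff: "coeff (rec_poly k a) n
      = (if n = k then 1 else 0) - (\<Sum>i=1..k. if k - i = n then a i else 0)" for n
    by (simp add: rec_poly_def coeff_sum)
  have hi: "(\<Sum>i=1..k. if k - i = n then a i else 0) = 0" if "n \<ge> k" for n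
    using that by (intro sum.neutral) auto
  show "coeff (rec_poly k a) k = 1" using hi[of k] unfolding coeff by simp
  show "coeff (rec_poly k a) j = 0" if "j > k" using hi[of j] that unfolding coeff by simp
  have "(\<Sum>i=1..k. if k - i = 0 then a i else 0) = (\<Sum>i=1..k. if i = k then a i else 0)"
    by (intro sum.cong) auto
  then show "coeff (rec_poly k a) 0 = - a k" using assms unfolding coeff by simp
qed

lemma act_rec_poly:
  assumes "\<And>n. u (n + k) = (\<Sum>i=1..k. a i * u (n + k - i))"
  shows "act (rec_poly k a) u = (\<lambda>_. 0)"
  by (simp add: rec_poly_def fun_eq_iff act_diff act_sum assms)

lemma char_poly_lrs_eq: "char_poly_lrs k a = rec_poly k (\<lambda>i. of_int (a i))"
  by (simp only: char_poly_lrs_def rec_poly_def)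

lemma degree_rec_poly:
  assumes "k \<ge> 1"
  shows "degree (rec_poly k a) = k"
proof (rule antisym)
  show "degree (rec_poly k a) \<le> k"
    using assms by (intro degree_le) (simp add: coeff_rec_poly)
  show "k \<le> degree (rec_poly k a)"
    using assms by (intro le_degree) (simp add: coeff_rec_poly)
qed

text \<open>Peeling off one linear factor, the induction hypothesis kills the image of
  \<open>z\<close> under it, so \<open>z\<close> is geometric with ratio \<open>ro K\<close>. On
  such a sequence \<open>S\<close> acts as the nonzero scalar \<open>poly S (ro K)\<close>.\<close>

lemma coprime_annihilators:
  fixes ro :: "nat \<Rightarrow> complex"
  assumes "act (\<Prod>i<K. [:- ro i, 1:]) z = (\<lambda>_. 0)" "act S z = (\<lambda>_. 0)"
    and "\<And>i. i < K \<Longrightarrow> poly S (ro i) \<noteq> 0"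
  shows "z = (\<lambda>_. 0)"
  using assms
proof (induction K arbitrary: z)
  case 0
  then show ?case by simp
next
  case (Suc K)
  define z' where "z' = act [:- ro K, 1:] z"
  have "z' = (\<lambda>_. 0)"
  proof (rule Suc.IH)
    show "act (\<Prod>i<K. [:- ro i, 1:]) z' = (\<lambda>_. 0)"
      using Suc.prems(1) by (simp add: z'_def act_mult del: mult_pCons_right)
    have "act S z' = act [:- ro K, 1:] (act S z)"
      unfolding z'_def act_mult[symmetric] by (simp only: mult.commute)
    then show "act S z' = (\<lambda>_. 0)" by (simp add: Suc.prems)
  qed (use Suc.prems in auto)
  then have step: "z (Suc n) = ro K * z n" for n
    by (simp add: z'_def fun_eq_iff act_pCons)
  have geometric: "z (n + m) = ro K ^ m * z n" for n m
    by (induction m) (simp_all add: step)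
  have "act S z n = poly S (ro K) * z n" for n
    by (simp add: act_def geometric poly_altdef sum_distrib_right mult.assoc)
  with Suc.prems show ?case by (auto simp: fun_eq_iff)
qed

text \<open>With E the shift and b one of the roots, the operator E^N - b^N removes one factor from
  the annihilator at the cost of one zero on the progression. By induction E^N acts on
  \<open>w\<close> as b^N. Among the given roots only b is a root of x^N - b^N, and it is a simple
  one, so \<open>w\<close> is geometric and a single zero makes it vanish. Repetitions among the
  \<open>ro i\<close> are allowed.\<close>

lemma zero_on_progression_imp_zero:
  fixes ro :: "nat \<Rightarrow> complex"
  assumes "N > 0" "act (\<Prod>i<K. [:- ro i, 1:]) w = (\<lambda>_. 0)"
    and "\<And>i. i < K \<Longrightarrow> ro i \<noteq> 0"
    and "\<And>i j. i < K \<Longrightarrow> j < K \<Longrightarrow> ro i ^ N = ro j ^ N \<Longrightarrow> ro i = ro j"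
    and "\<And>m. m < K \<Longrightarrow> w (r + N * m) = 0"
  shows "w = (\<lambda>_. 0)"
  using assms(2-)
proof (induction K arbitrary: w)
  case 0
  then show ?case by simp
next
  case (Suc K)
  define b where "b = ro K"
  define P where "P = (\<Prod>i<Suc K. [:- ro i, 1:])"
  have "poly (monom 1 N - [:b ^ N:]) b = 0" by (simp add: poly_monom)
  then obtain q where q: "monom 1 N - [:b ^ N:] = [:- b, 1:] * q"
    unfolding poly_eq_0_iff_dvd by (auto elim: dvdE)
  define w' where "w' = act (monom 1 N - [:b ^ N:]) w"
  have w'_eq: "w' n = w (n + N) - b ^ N * w n" for n
    by (simp add: w'_def act_diff act_pCons)
  have w'_0: "w' = (\<lambda>_. 0)"
  proof (rule Suc.IH)
    have "act (\<Prod>i<K. [:- ro i, 1:]) w' = act q (act P w)"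
      unfolding w'_def q P_def act_mult[symmetric] prod.lessThan_Suc b_def[symmetric]
      by (rule arg_cong[where f = "\<lambda>p. act p w"]) (simp only: mult_ac)
    then show "act (\<Prod>i<K. [:- ro i, 1:]) w' = (\<lambda>_. 0)"
      using Suc.prems(1) by (simp add: P_def)
    show "w' (r + N * m) = 0" if "m < K" for m
      using Suc.prems(4)[of m] Suc.prems(4)[of "Suc m"] that
      by (simp add: w'_eq algebra_simps)
  qed (use Suc.prems in auto)
  have b0: "b \<noteq> 0" using Suc.prems(2) by (simp add: b_def)
  \<comment> \<open>\<open>z\<close> measures how far \<open>w\<close> is from being geometric with
    ratio \<open>b\<close>. It is annihilated by \<open>P\<close>, and by \<open>q\<close> because
    \<open>w'\<close> vanishes.\<close>
  define z where "z = act [:- b, 1:] w"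
  have "z = (\<lambda>_. 0)"
  proof (rule coprime_annihilators)
    have "act P z = act [:- b, 1:] (act P w)"
      unfolding z_def act_mult[symmetric] by (simp only: mult.commute)
    then show "act (\<Prod>i<Suc K. [:- ro i, 1:]) z = (\<lambda>_. 0)"
      using Suc.prems(1) by (simp add: P_def)
    show "act q z = (\<lambda>_. 0)"
      using w'_0 unfolding w'_def q z_def act_mult[symmetric] by (simp only: mult.commute)
    fix i assume i: "i < Suc K"
    show "poly q (ro i) \<noteq> 0"
    proof (cases "ro i = b")
      case True
      \<comment> \<open>Differentiating the factorisation of x^N - b^N gives q(b) = N b^(N-1), which
        is nonzero in characteristic 0.\<close>
      have "poly (pderiv (monom 1 N - [:b ^ N:])) b = poly q b"
        unfolding q by (simp add: pderiv_mult pderiv_pCons del: mult_pCons_left)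
      then have "poly q b = of_nat N * b ^ (N - 1)"
        by (simp add: pderiv_diff pderiv_monom poly_monom pderiv_pCons)
      with True b0 \<open>N > 0\<close> show ?thesis by simp
    next
      case False
      then have "ro i ^ N \<noteq> b ^ N" using Suc.prems(3)[OF i, of K] by (auto simp: b_def)
      moreover have "ro i ^ N - b ^ N = (ro i - b) * poly q (ro i)"
        using arg_cong[OF q, of "\<lambda>p. poly p (ro i)"] by (simp add: poly_monom algebra_simps)
      ultimately show ?thesis by auto
    qed
  qed
  then have step: "w (Suc n) = b * w n" for n
    by (simp add: z_def fun_eq_iff act_pCons)
  have geometric: "w n = b ^ n * w 0" for n
    by (induction n) (simp_all add: step)
  have "w r = 0" using Suc.prems(4)[of 0] by simp
  with geometric[of r] b0 have "w 0 = 0" by simp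
  then show ?case by (subst fun_eq_iff, subst geometric) simp
qed

text \<open>The previous lemma is applied to the minimal recurrence, the one whose roots
  nondegeneracy controls; its order is at most \<open>k\<close>. Distinct roots with equal N-th
  powers would have a root of unity as quotient, and the nonzero last coefficient keeps all roots
  away from 0.\<close>

lemma nondegenerate_progression:
  assumes "lrs k a u" "nondegenerate u" "N > 0"
  shows "\<exists>m<k. u (r + N * m) \<noteq> 0"
proof (rule ccontr)
  assume contr: "\<not> (\<exists>m<k. u (r + N * m) \<noteq> 0)"
  from assms(2) obtain k' a' where min: "minimal_recurrence k' a' u"
    and nd: "\<And>\<alpha> \<beta>. poly (char_poly_lrs k' a') \<alpha> = 0 \<Longrightarrow> poly (char_poly_lrs k' a') \<beta> = 0 \<Longrightarrow>
      \<alpha> \<noteq> \<beta> \<Longrightarrow> \<not> root_of_unity (\<alpha> / \<beta>)"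
    unfolding nondegenerate_def by blast
  have "k' \<le> k" and lrs': "lrs k' a' u"
    using min assms(1) by (auto simp: minimal_recurrence_def)
  define P where "P = rec_poly k' (\<lambda>i. of_int (a' i) :: complex)"
  define w where "w n = (of_int (u n) :: complex)" for n
  have k': "k' \<ge> 1" and a': "a' k' \<noteq> 0" using lrs' by (auto simp: lrs_def)
  obtain ro where "smult (lead_coeff P) (\<Prod>i<degree P. [:- ro i, 1:]) = P"
    using complex_poly_decompose' by blast
  then have P: "P = (\<Prod>i<k'. [:- ro i, 1:])"
    by (simp add: P_def degree_rec_poly[OF k'] coeff_rec_poly(1)[OF k'])
  have root: "poly P (ro i) = 0" if "i < k'" for i
    using that by (auto simp: P poly_prod)
  have "poly P 0 \<noteq> 0"
    using k' a' by (simp add: P_def poly_0_coeff_0 coeff_rec_poly)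
  then have nz: "ro i \<noteq> 0" if "i < k'" for i
    using root[OF that] by metis
  have "w = (\<lambda>_. 0)"
  proof (rule zero_on_progression_imp_zero[OF \<open>N > 0\<close>])
    have "w (n + k') = (\<Sum>i=1..k'. of_int (a' i) * w (n + k' - i))" for n
      using lrs' by (simp add: lrs_def w_def)
    from act_rec_poly[OF this] show "act (\<Prod>i<k'. [:- ro i, 1:]) w = (\<lambda>_. 0)"
      by (simp only: P[symmetric] P_def)
    show "ro i \<noteq> 0" if "i < k'" for i by (rule nz) fact
    show "w (r + N * m) = 0" if "m < k'" for m
      using contr that \<open>k' \<le> k\<close> by (auto simp: w_def)
    fix i j assume ij: "i < k'" "j < k'" "ro i ^ N = ro j ^ N"
    then have "(ro i / ro j) ^ N = 1" using nz[of j] by (simp add: power_divide)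
    then have "root_of_unity (ro i / ro j)"
      using \<open>N > 0\<close> by (auto simp: root_of_unity_def intro!: exI[of _ N])
    then show "ro i = ro j" using nd root ij by (auto simp: P_def char_poly_lrs_eq)
  qed
  then show False using assms(2) by (simp add: nondegenerate_def w_def fun_eq_iff)
qed

subsection \<open>Divisibility by roots\<close>

text \<open>A weak form of Legendre's formula. Writing n = p m + r with r < p, only the multiples of
  p contribute, so n! is p^m m! times a factor prime to p, and the induction continues with m. The
  bound on \<open>t\<close> is what makes p^j / j! a p-adic integer.\<close>

lemma prime_power_fact:
  assumes "prime (p::nat)"
  shows "\<exists>t d. fact n = p ^ t * d \<and> t \<le> n \<and> coprime d p"
proof -
  have block: "\<exists>d. fact (p * m + r) = p ^ m * fact m * d \<and> coprime d p" if "r < p" for m r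
  proof -
    have tail: "\<exists>d. fact (p * m + r) = fact (p * m) * d \<and> coprime d p" if "r < p" for m r
      using that
    proof (induction r)
      case 0
      show ?case by (intro exI[of _ 1]) simp
    next
      case (Suc r)
      then obtain d where d: "fact (p * m + r) = fact (p * m) * d" "coprime d p" by auto
      have "coprime (p * m + Suc r) p"
      proof -
        have "\<not> p dvd Suc r" using Suc.prems by (auto dest: dvd_imp_le)
        then have "\<not> p dvd p * m + Suc r" by (metis dvd_add_right_iff dvd_triv_left)
        then show ?thesis using assms by (metis coprime_commute prime_imp_coprime)
      qed
      then have "coprime (d * (p * m + Suc r)) p"
        using d by (simp only: coprime_mult_left_iff)
      moreover have "fact (p * m + Suc r) = fact (p * m) * (d * (p * m + Suc r))"
        by (simp only: add_Suc_right fact_Suc of_nat_id d(1)) (simp only: mult_ac)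
      ultimately show ?case by blast
    qed
    have p1: "p > 1" using assms by (rule prime_gt_1_nat)
    have "\<exists>d. fact (p * m) = p ^ m * fact m * d \<and> coprime d p"
    proof (induction m)
      case 0
      show ?case by (intro exI[of _ 1]) simp
    next
      case (Suc m)
      then obtain d where d: "fact (p * m) = p ^ m * fact m * d" "coprime d p" by auto
      from tail[of "p - 1" m] p1 obtain e where
        e: "fact (p * m + (p - 1)) = fact (p * m) * e" "coprime e p" by auto
      have "p * Suc m = Suc (p * m + (p - 1))" using p1 by simp
      then have "fact (p * Suc m) = (p * Suc m) * fact (p * m + (p - 1))"
        by (metis fact_Suc of_nat_id)
      also have "\<dots> = p ^ Suc m * fact (Suc m) * (d * e)"
        by (simp only: e(1) d(1)) (simp only: fact_Suc of_nat_id power_Suc mult_ac)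
      finally show ?case using d e by auto
    qed
    with tail[OF that, of m] show ?thesis by (metis coprime_mult_left_iff mult.assoc)
  qed
  show ?thesis
  proof (induction n rule: less_induct)
    case (less n)
    have p2: "p \<ge> 2" using assms by (rule prime_ge_2_nat)
    show ?case
    proof (cases "n = 0")
      case True
      then show ?thesis by (intro exI[of _ 0] exI[of _ 1]) simp
    next
      case False
      define m where "m = n div p"
      have "m < n" using False p2 by (simp add: m_def)
      with less obtain t d where td: "fact m = p ^ t * d" "t \<le> m" "coprime d p" by blast
      from block[of "n mod p" m] p2 obtain e where
        "fact (p * m + n mod p) = p ^ m * fact m * e" "coprime e p" by auto
      moreover have "p * m + n mod p = n" by (simp add: m_def)
      ultimately have "fact n = p ^ (m + t) * (d * e)" "coprime (d * e) p"
        using td by (simp_all add: power_add)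
      moreover have "m + t \<le> n"
      proof -
        have "m + t \<le> 2 * m" using td by simp
        also have "\<dots> \<le> p * m" using p2 by simp
        also have "\<dots> \<le> n" by (simp add: m_def)
        finally show ?thesis .
      qed
      ultimately show ?thesis by blast
    qed
  qed
qed

section \<open>Strassmann's argument for binomial expansions\<close>

lemma fact_binomial_eq_prod:
  "int (fact j) * int (s choose j) = (\<Prod>i<j. int s - int i)"
proof (induction j)
  case (Suc j)
  show ?case
  proof (cases "j \<le> s")
    case True
    have "Suc j * (s choose Suc j) = (s - j) * (s choose j)"
      using binomial_absorption[of j s] binomial_absorb_comp[of s j] by simp
    then have "int (Suc j) * int (s choose Suc j) = (int s - int j) * int (s choose j)"
      using True by (metis of_nat_mult of_nat_diff)
    then have "int (fact (Suc j)) * int (s choose Suc j)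
        = int (fact j) * int (s choose j) * (int s - int j)"
      by (simp only: fact_Suc of_nat_mult of_nat_id mult_ac)
    then show ?thesis
      by (simp only: Suc prod.lessThan_Suc)
  next
    case False
    then have zero: "(\<Prod>i<Suc j. int s - int i) = 0" by (intro prod_zero) auto
    have "s choose Suc j = 0" using False by simp
    then show ?thesis by (simp only: zero of_nat_0 mult_zero_right)
  qed
qed simp

text \<open>Removing a root from a polynomial with \<open>q ^ i\<close> dividing the coefficient of \<open>x ^ i\<close>
  shifts this divisibility by one.\<close>

lemma power_dvd_poly_of_roots:
  fixes F :: "int poly"
  assumes "finite Z" "\<And>z. z \<in> Z \<Longrightarrow> poly F z = 0" "\<And>i. q ^ (i + e) dvd coeff F i"
  shows "q ^ (card Z + e) dvd poly F s"
  using assms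
proof (induction Z arbitrary: F e rule: finite_induct)
  case empty
  have "q ^ e dvd coeff F i * s ^ i" for i
    using empty(2)[of i] by (intro dvd_mult2) (simp add: power_le_dvd)
  then show ?case by (simp add: poly_altdef dvd_sum)
next
  case (insert z Z)
  from insert.prems(1)[of z] obtain G where G: "F = [:- z, 1:] * G"
    by (auto simp: poly_eq_0_iff_dvd)
  have coeff: "coeff G i = coeff F (Suc i) + z * coeff G (Suc i)" for i
    by (simp add: G)
  \<comment> \<open>The relation \<open>coeff\<close> determines the coefficients of
    \<open>G\<close> from the top down, so the induction descends from just beyond the degree, where
    they vanish.\<close>
  have "q ^ (i + Suc e) dvd coeff G i" if "i \<le> Suc (degree G)" for i
    using that
  proof (induction i rule: inc_induct)
    case base
    show ?case by (simp add: coeff_eq_0)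
  next
    case (step i)
    have "q ^ (i + Suc e) dvd coeff F (Suc i)"
      using insert.prems(2)[of "Suc i"] by simp
    moreover have "q ^ (i + Suc e) dvd coeff G (Suc i)"
      by (rule power_le_dvd[OF step.IH]) simp
    ultimately show ?case by (subst coeff) (intro dvd_add dvd_mult)
  qed
  then have "q ^ (i + Suc e) dvd coeff G i" for i
    by (cases "i \<le> Suc (degree G)") (simp_all add: coeff_eq_0)
  moreover have "poly G z' = 0" if "z' \<in> Z" for z'
    using insert.prems(1)[of z'] insert.hyps that by (auto simp: G)
  ultimately have "q ^ (card Z + Suc e) dvd poly G s"
    by (intro insert.IH) auto
  then show ?case using insert.hyps by (simp add: G)
qed

text \<open>Up to a factor prime to p, \<open>v\<close> agrees on a finite range with an integer
  polynomial \<open>F\<close>, as j! (t choose j) is a polynomial of degree j in t. Dividing p^(2j)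
  by j! leaves at least p^j, and only terms with j at least i reach the coefficient of x^i, so p^i
  divides it and \<open>power_dvd_poly_of_roots\<close> applies.\<close>

lemma power_dvd_of_zeros:
  fixes b :: "nat \<Rightarrow> int"
  assumes "prime p" and v: "\<And>t. v t = (\<Sum>j\<le>t. int (t choose j) * int p ^ (2 * j) * b j)"
    and "finite Z" "\<And>z. z \<in> Z \<Longrightarrow> v z = 0"
  shows "int p ^ card Z dvd v s"
proof -
  from prime_power_fact[OF \<open>prime p\<close>] obtain t d where
    fact: "\<And>j. fact j = p ^ t j * d j" and t: "\<And>j. t j \<le> j" and d: "\<And>j. coprime (d j) p"
    by metis
  \<comment> \<open>All arguments of interest are at most \<open>M\<close>. Summands with index
    above the argument vanish, so one polynomial of degree at most \<open>M\<close> serves them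
    all.\<close>
  define M where "M = Max (insert s Z)"
  \<comment> \<open>\<open>D\<close> clears the p-free parts of the factorials, so that
    \<open>c j\<close> is D p^(2j) b_j / j!. Being prime to p, it cancels at the end.\<close>
  define D where "D = int (\<Prod>j\<le>M. d j)"
  define c where "c j = int (\<Prod>i\<in>{..M} - {j}. d i) * int p ^ (2 * j - t j) * b j" for j
  define G where "G j = (\<Prod>i<j. [:- int i, 1:])" for j
  define F where "F = (\<Sum>j\<le>M. smult (c j) (G j))"
  have poly_F: "poly F (int x) = D * v x" if "x \<le> M" for x
  proof -
    have "c j * (\<Prod>i<j. int x - int i) = D * (int (x choose j) * int p ^ (2 * j) * b j)"
      if "j \<le> M" for j
    proof -
      have "D = int (d j) * int (\<Prod>i\<in>{..M} - {j}. d i)"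
        unfolding D_def using that by (subst prod.remove[of _ j]) auto
      moreover have "int p ^ (2 * j) = int p ^ (2 * j - t j) * int p ^ t j"
        using t[of j] by (simp flip: power_add)
      moreover have "(\<Prod>i<j. int x - int i) = int p ^ t j * int (d j) * int (x choose j)"
        unfolding fact_binomial_eq_prod[symmetric] by (simp add: fact)
      ultimately show ?thesis by (simp add: c_def)
    qed
    then have "poly F (int x) = (\<Sum>j\<le>M. D * (int (x choose j) * int p ^ (2 * j) * b j))"
      by (simp add: F_def G_def poly_sum poly_prod)
    also have "\<dots> = (\<Sum>j\<le>x. D * (int (x choose j) * int p ^ (2 * j) * b j))"
      by (rule sum.mono_neutral_right) (use that in auto)
    finally show ?thesis by (simp add: v sum_distrib_left)
  qed
  have M: "x \<le> M" if "x \<in> insert s Z" for x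
    unfolding M_def using that \<open>finite Z\<close> by (intro Max_ge) auto
  have "int p ^ (card (int ` Z) + 0) dvd poly F (int s)"
  proof (rule power_dvd_poly_of_roots)
    show "poly F z = 0" if "z \<in> int ` Z" for z
      using that poly_F M assms(4) by auto
    fix i
    have "int p ^ i dvd coeff (smult (c j) (G j)) i" for j
    proof (cases "i \<le> j")
      case True
      have "int p ^ i dvd int p ^ (2 * j - t j)"
        using True t[of j] by (intro le_imp_power_dvd) simp
      then show ?thesis by (simp add: c_def)
    next
      case False
      have "degree (G j) \<le> (\<Sum>i<j. 1)"
        unfolding G_def by (rule order.trans[OF degree_prod_sum_le]) auto
      with False show ?thesis by (simp add: coeff_eq_0)
    qed
    then show "int p ^ (i + 0) dvd coeff F i"
      by (simp add: F_def coeff_sum dvd_sum del: coeff_smult)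
  qed (use \<open>finite Z\<close> in simp)
  then have "int p ^ card Z dvd D * v s"
    using poly_F[OF M, of s] by (simp add: card_image)
  moreover have "coprime (int p ^ card Z) D"
    unfolding D_def using d
    by (auto simp: coprime_commute intro!: prod_coprime_right)
  ultimately show ?thesis by (simp add: coprime_dvd_mult_right_iff)
qed

subsection \<open>Zeros of one sequence\<close>

text \<open>A monic divisor requires no inverses, so this works over the integers: multiply the
  previous remainder by x and subtract its overflowing top coefficient times
  \<open>f\<close>.\<close>

lemma monic_remainder:
  fixes f :: "'a::comm_ring_1 poly"
  assumes "k \<ge> 1" "coeff f k = 1" "\<And>j. j > k \<Longrightarrow> coeff f j = 0"
  shows "\<exists>A R. monom 1 i = f * A + R \<and> (\<forall>j\<ge>k. coeff R j = 0)"
proof (induction i)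
  case 0
  show ?case using \<open>k \<ge> 1\<close> by (intro exI[of _ 0] exI[of _ 1]) auto
next
  case (Suc i)
  then obtain A R where AR: "monom 1 i = f * A + R" "\<And>j. j \<ge> k \<Longrightarrow> coeff R j = 0" by auto
  define c where "c = coeff R (k - 1)"
  define R' where "R' = pCons 0 R - smult c f"
  have "monom 1 (Suc i) = f * (pCons 0 A + [:c:]) + R'"
    by (simp add: monom_Suc AR(1) R'_def algebra_simps)
  moreover have "coeff R' j = 0" if "j \<ge> k" for j
  proof (cases "j = k")
    case True
    with assms show ?thesis by (cases k) (simp_all add: R'_def c_def)
  next
    case False
    with that assms AR(2)[of "j - 1"] show ?thesis by (cases j) (simp_all add: R'_def)
  qed
  ultimately show ?case by blast
qed

text \<open>The class of x is a unit modulo (f, m): f is its constant term plus a multiple of x, and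
  that constant term is invertible modulo m.\<close>

lemma cancel_monom_mod:
  fixes f P :: "int poly"
  assumes "coprime (coeff f 0) m" "\<exists>A B. monom 1 i * P = f * A + [:m:] * B"
  shows "\<exists>A B. P = f * A + [:m:] * B"
  using assms(2)
proof (induction i)
  case 0
  then show ?case by (simp add: one_pCons[symmetric])
next
  case (Suc i)
  then obtain A B where AB: "[:0, 1:] * (monom 1 i * P) = f * A + [:m:] * B"
    by (auto simp: monom_Suc)
  obtain g where f: "f = [:coeff f 0:] + [:0, 1:] * g"
    by (cases f) auto
  from assms(1) obtain b e where "b * coeff f 0 + e * m = 1"
    by (metis bezout_int coprime_iff_gcd_eq_1)
  then have "[:b:] * [:coeff f 0:] + [:e:] * [:m:] = 1" by (simp add: one_pCons mult.commute)
  then have one: "[:b:] * f + [:e:] * [:m:] - [:0, 1:] * ([:b:] * g) = 1"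
    by (subst f) (simp only: algebra_simps)
  define Q where "Q = monom 1 i * P"
  have "Q = ([:b:] * f + [:e:] * [:m:] - [:0, 1:] * ([:b:] * g)) * Q"
    unfolding one by simp
  also have "\<dots> = [:b:] * f * Q + [:e:] * [:m:] * Q - [:b:] * g * ([:0, 1:] * Q)"
    by (simp only: algebra_simps)
  also have "\<dots> = f * ([:b:] * Q - [:b:] * g * A) + [:m:] * ([:e:] * Q - [:b:] * g * B)"
    unfolding AB[folded Q_def] by (simp only: algebra_simps)
  finally show ?case using Suc.IH unfolding Q_def by blast
qed

text \<open>Remainders modulo (f, m) are encoded by lists of \<open>k\<close> residues, of which
  there are m^k. Two of the first m^k + 1 powers of x therefore agree, and the smaller one can be
  cancelled because x is a unit.\<close>

lemma ex_period_mod: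
  fixes f :: "int poly"
  assumes f: "k \<ge> 1" "coeff f k = 1" "\<And>j. j > k \<Longrightarrow> coeff f j = 0"
    and "coprime (coeff f 0) (int m)" "m > 0"
  shows "\<exists>N A g. 0 < N \<and> N \<le> m ^ k \<and> monom 1 N = 1 + (f * A + [:int m:] * g)"
proof -
  obtain A R where R: "\<And>i. monom 1 i = f * A i + R i" "\<And>i j. j \<ge> k \<Longrightarrow> coeff (R i) j = 0"
    using monic_remainder[OF f] by metis
  define L where "L = {xs. set xs \<subseteq> {0..<int m} \<and> length xs = k}"
  define \<phi> where "\<phi> i = map (\<lambda>j. coeff (R i) j mod int m) [0..<k]" for i
  have "card L = m ^ k" unfolding L_def by (subst card_lists_length_eq) auto
  moreover have "finite L" unfolding L_def by (rule finite_lists_length_eq) simp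
  moreover have "\<phi> ` {..m ^ k} \<subseteq> L"
    using \<open>m > 0\<close> by (auto simp: L_def \<phi>_def)
  ultimately have "card (\<phi> ` {..m ^ k}) \<le> m ^ k" by (metis card_mono)
  then have "\<not> inj_on \<phi> {..m ^ k}" by (intro pigeonhole) simp
  then obtain i j where "i \<le> m ^ k" "j \<le> m ^ k" "\<phi> i = \<phi> j" "i \<noteq> j"
    by (auto simp: inj_on_def)
  then obtain i N where ij: "i + N \<le> m ^ k" "\<phi> i = \<phi> (i + N)" "N > 0"
    by (metis add.commute le_add_diff_inverse2 linorder_neqE_nat order.strict_implies_order zero_less_diff)
  have "int m dvd coeff (R (i + N) - R i) j" for j
  proof (cases "j < k")
    case True
    have "\<phi> i ! j = \<phi> (i + N) ! j" using ij by simp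
    with True have "coeff (R (i + N)) j mod int m = coeff (R i) j mod int m"
      by (simp add: \<phi>_def)
    then show ?thesis by (simp add: mod_eq_dvd_iff)
  qed (use R(2) in auto)
  then have "[:int m:] dvd R (i + N) - R i"
    unfolding const_poly_dvd_iff by blast
  then obtain B where B: "R (i + N) - R i = [:int m:] * B" by (rule dvdE)
  have "monom 1 i * (monom 1 N - 1) = (monom 1 (i + N) - monom 1 i :: int poly)"
    by (simp add: algebra_simps mult_monom)
  also have "\<dots> = f * (A (i + N) - A i) + (R (i + N) - R i)"
    by (simp only: R(1)[of "i + N"] R(1)[of i]) (simp only: algebra_simps)
  finally obtain A' B' where "monom 1 N - 1 = f * A' + [:int m:] * B'"
    using cancel_monom_mod[OF assms(4)] B by metis
  then have "monom 1 N = 1 + (f * A' + [:int m:] * B')" by (simp only: algebra_simps)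
  with ij show ?thesis by (metis add_leD2)
qed

text \<open>The shift by \<open>N\<close> acts on \<open>u\<close> as 1 + D, and D^j acts as m^j g^j
  because the two differ by a multiple of the annihilator \<open>f\<close>. The binomial theorem
  does the rest.\<close>

lemma annihilated_expansion:
  fixes f :: "int poly"
  assumes "act f u = (\<lambda>_. 0)" and N: "monom 1 N = 1 + (f * A + [:m:] * g)"
  shows "u (r + N * t) = (\<Sum>j\<le>t. int (t choose j) * m ^ j * act (g ^ j) u r)"
proof -
  define D where "D = f * A + [:m:] * g"
  have D: "act (D ^ j) u n = m ^ j * act (g ^ j) u n" for j n
  proof -
    have "\<exists>C. D ^ j = C * f + [:m ^ j:] * g ^ j"
    proof (induction j)
      case 0
      show ?case by (intro exI[of _ 0]) (simp add: one_pCons)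
    next
      case (Suc j)
      then obtain C where C: "D ^ j = C * f + [:m ^ j:] * g ^ j" by blast
      have "[:m ^ Suc j:] = [:m:] * [:m ^ j:]" by simp
      then have "D ^ Suc j = (D * C + A * ([:m ^ j:] * g ^ j)) * f + [:m ^ Suc j:] * g ^ Suc j"
        unfolding power_Suc[of D] power_Suc[of g] C by (simp only: D_def algebra_simps)
      then show ?case by blast
    qed
    then obtain C where "D ^ j = C * f + [:m ^ j:] * g ^ j" by blast
    then have "D ^ j = C * f + smult (m ^ j) (g ^ j)" by simp
    then show ?thesis by (simp only: act_add act_mult assms act_const_0 act_smult add_0)
  qed
  have "u (r + N * t) = act (monom 1 N ^ t) u r"
    by (simp add: monom_power)
  also have "monom 1 N ^ t = (D + 1) ^ t" by (simp add: N D_def add.commute)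
  also have "\<dots> = (\<Sum>j\<le>t. smult (int (t choose j)) (D ^ j))"
    by (simp add: binomial_ring of_nat_poly)
  finally show ?thesis by (simp add: act_sum act_smult D mult.assoc)
qed

section \<open>Growth and number of zeros in terms of the height\<close>

lemma height_bounds:
  assumes "height k a u \<le> T"
  shows "int k \<le> T" "i \<in> {1..k} \<Longrightarrow> \<bar>a i\<bar> \<le> T" "i < k \<Longrightarrow> \<bar>u i\<bar> \<le> T"
proof -
  let ?S = "{int k} \<union> (\<lambda>i. \<bar>a i\<bar>) ` {1..k} \<union> (\<lambda>i. \<bar>u i\<bar>) ` {..<k}"
  have S: "x \<le> T" if "x \<in> ?S" for x
  proof -
    have "x \<le> Max ?S" by (rule Max_ge) (use that in auto)
    with assms show ?thesis by (simp only: height_def)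
  qed
  show "int k \<le> T" by (rule S) simp
  show "\<bar>a i\<bar> \<le> T" if "i \<in> {1..k}" by (rule S) (use that in auto)
  show "\<bar>u i\<bar> \<le> T" if "i < k" by (rule S) (use that in auto)
qed

text \<open>Each new term is a sum of at most T products with coefficients at most T in absolute
  value, so every index costs two factors T; the initial values account for the extra one.\<close>

lemma lrs_growth:
  assumes "lrs k a u" "height k a u \<le> int T"
  shows "\<bar>u n\<bar> \<le> int T ^ (2 * n + 1)"
proof (induction n rule: less_induct)
  case (less n)
  note bounds = height_bounds[OF assms(2)]
  have k: "k \<ge> 1" using assms(1) by (simp add: lrs_def)
  with bounds(1) have T1: "int T \<ge> 1" by simp
  show ?case
  proof (cases "n < k")
    case True
    have "int T ^ 1 \<le> int T ^ (2 * n + 1)" by (rule power_increasing) (use T1 in auto)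
    with bounds(3)[OF True] show ?thesis by simp
  next
    case False
    then obtain n' where n: "n = n' + k" by (metis add.commute le_Suc_ex not_le)
    have "u n = (\<Sum>i=1..k. a i * u (n - i))"
      using assms(1) by (simp add: lrs_def n)
    then have "\<bar>u n\<bar> \<le> (\<Sum>i=1..k. \<bar>a i * u (n - i)\<bar>)" by simp
    also have "\<dots> \<le> (\<Sum>i=1..k. int T * int T ^ (2 * n - 1))"
    proof (rule sum_mono)
      fix i assume i: "i \<in> {1..k}"
      have "\<bar>u (n - i)\<bar> \<le> int T ^ (2 * (n - i) + 1)"
        by (rule less.IH) (use i False k in auto)
      also have "\<dots> \<le> int T ^ (2 * n - 1)"
        by (rule power_increasing) (use i T1 False in auto)
      finally show "\<bar>a i * u (n - i)\<bar> \<le> int T * int T ^ (2 * n - 1)"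
        unfolding abs_mult using bounds(2)[OF i] by (intro mult_mono) auto
    qed
    also have "\<dots> = int k * (int T * int T ^ (2 * n - 1))" by simp
    also have "\<dots> \<le> int T * (int T * int T ^ (2 * n - 1))"
      using bounds(1) by (intro mult_right_mono) auto
    also have "\<dots> = int T ^ (2 * n + 1)"
      using False k by (cases n) (simp_all add: power_add)
    finally show ?thesis .
  qed
qed

text \<open>The expansion with modulus \<open>p\<^sup>2\<close> makes p^(card Z) divide every term
  of the progression, in particular a nonzero one with s < k. The growth bound for that term limits
  \<open>card Z\<close>.\<close>

lemma zeros_in_progression:
  assumes "lrs k a u" "nondegenerate u" "height k a u \<le> int T"
    and "prime p" "N > 0" "monom 1 N = 1 + (rec_poly k a * A + [:int (p\<^sup>2):] * g)" "r < N"
    and "finite Z" "\<And>t. t \<in> Z \<Longrightarrow> u (r + N * t) = 0"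
  shows "card Z \<le> 2 * N * T\<^sup>2"
proof -
  have k: "k \<ge> 1" using assms(1) by (simp add: lrs_def)
  have kT: "k \<le> T" using height_bounds(1)[OF assms(3)] by simp
  obtain s where s: "s < k" "u (r + N * s) \<noteq> 0"
    using nondegenerate_progression[OF assms(1,2,5)] by blast
  have "int p ^ card Z dvd u (r + N * s)"
  proof (rule power_dvd_of_zeros[where v = "\<lambda>t. u (r + N * t)"])
    show "u (r + N * t) = (\<Sum>j\<le>t. int (t choose j) * int p ^ (2 * j) * act (g ^ j) u r)" for t
      using annihilated_expansion[OF act_rec_poly assms(6), of u r t] assms(1)
      by (simp add: lrs_def power_mult)
  qed (use assms in auto)
  then have "int p ^ card Z \<le> \<bar>u (r + N * s)\<bar>"
    using s by (auto dest: dvd_imp_le_int)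
  also have "\<dots> \<le> int T ^ (2 * (r + N * s) + 1)"
    by (rule lrs_growth) fact+
  also have "\<dots> \<le> int T ^ (2 * N * T)"
  proof (rule power_increasing)
    have "r + N * s + 1 \<le> N * (s + 1)" using \<open>r < N\<close> by simp
    also have "\<dots> \<le> N * T" using s kT by (intro mult_left_mono) auto
    finally show "2 * (r + N * s) + 1 \<le> 2 * N * T" by simp
  qed (use k kT in auto)
  finally have "p ^ card Z \<le> T ^ (2 * N * T)"
    by (simp flip: of_nat_power)
  \<comment> \<open>The crude estimate T < 2^T turns the bound into a power of 2, to be compared
    with 2^(card Z).\<close>
  also have "\<dots> \<le> (2 ^ T) ^ (2 * N * T)"
    by (intro power_mono) (simp_all add: less_imp_le)
  finally have "p ^ card Z \<le> 2 ^ (2 * N * T\<^sup>2)"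
    by (simp add: power2_eq_square mult_ac flip: power_mult)
  moreover have "2 ^ card Z \<le> p ^ card Z"
    using prime_ge_2_nat[OF \<open>prime p\<close>] by (intro power_mono) auto
  ultimately have "(2::nat) ^ card Z \<le> 2 ^ (2 * N * T\<^sup>2)" by (rule order.trans[rotated])
  then show ?thesis by (rule power_le_imp_le_exp[rotated]) simp
qed

lemma card_zeros_lrs:
  assumes "lrs k a u" "nondegenerate u" "height k a u \<le> int T"
  shows "finite {n. u n = 0}" "card {n. u n = 0} \<le> 2 * T\<^sup>2 * (T + 1) ^ (4 * T)"
proof -
  note bounds = height_bounds[OF assms(3)]
  have k: "k \<ge> 1" "a k \<noteq> 0" using assms(1) by (simp_all add: lrs_def)
  have kT: "k \<le> T" using bounds(1) by simp
  have ak: "nat \<bar>a k\<bar> \<le> T" using bounds(2)[of k] k by simp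
  \<comment> \<open>A prime factor of |a k| + 1 is at most T + 1 and does not divide
    \<open>a k\<close>, so the constant coefficient of the characteristic polynomial is invertible
    modulo \<open>p\<^sup>2\<close>.\<close>
  have "nat \<bar>a k\<bar> + 1 \<noteq> 1" using k by simp
  then obtain p where p: "prime p" "p dvd nat \<bar>a k\<bar> + 1"
    using prime_factor_nat by blast
  have "p \<le> nat \<bar>a k\<bar> + 1" by (rule dvd_imp_le) (use p in auto)
  then have pT: "p \<le> T + 1" using ak by simp
  have "\<not> p dvd nat \<bar>a k\<bar>"
    using p by (metis dvd_add_right_iff not_prime_unit)
  then have "coprime (nat \<bar>a k\<bar>) p"
    using p(1) by (metis coprime_commute prime_imp_coprime)
  then have "coprime (int (nat \<bar>a k\<bar>)) (int p)" by (simp only: coprime_int_iff)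
  then have "coprime (a k) (int p)" by simp
  then have "coprime (coeff (rec_poly k a) 0) (int (p\<^sup>2))"
    using k by (simp add: coeff_rec_poly)
  then obtain N A g where N: "0 < N" "N \<le> (p\<^sup>2) ^ k"
    "monom 1 N = 1 + (rec_poly k a * A + [:int (p\<^sup>2):] * g)"
    using ex_period_mod[of k "rec_poly k a" "p\<^sup>2"] k prime_gt_0_nat[OF p(1)]
    by (auto simp: coeff_rec_poly)
  have "N \<le> p ^ (2 * k)" using N by (simp add: power_mult)
  also have "\<dots> \<le> (T + 1) ^ (2 * k)" using pT by (intro power_mono) auto
  also have "\<dots> \<le> (T + 1) ^ (2 * T)" using kT by (intro power_increasing) auto
  finally have NT: "N \<le> (T + 1) ^ (2 * T)" .
  define Z where "Z r = {t. u (r + N * t) = 0}" for r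
  \<comment> \<open>The bound is uniform over finite sets of zeros, which yields the finiteness of
    \<open>Z r\<close> itself.\<close>
  have card_le: "card F \<le> 2 * N * T\<^sup>2" if "F \<subseteq> Z r" "finite F" "r < N" for F r
    using zeros_in_progression[OF assms p(1) N(1,3) that(3,2)] that(1) by (auto simp: Z_def)
  have Z: "finite (Z r)" "card (Z r) \<le> 2 * N * T\<^sup>2" if "r < N" for r
    using finite_if_finite_subsets_card_bdd[of "Z r" "2 * N * T\<^sup>2"] card_le that by blast+
  have subset: "{n. u n = 0} \<subseteq> (\<Union>r<N. (\<lambda>t. r + N * t) ` Z r)"
  proof
    fix n assume "n \<in> {n. u n = 0}"
    then have "n div N \<in> Z (n mod N)" by (simp add: Z_def)
    then have "n mod N + N * (n div N) \<in> (\<lambda>t. n mod N + N * t) ` Z (n mod N)"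
      by (rule imageI)
    moreover have "n mod N + N * (n div N) = n" by simp
    moreover have "n mod N \<in> {..<N}" using N(1) by simp
    ultimately show "n \<in> (\<Union>r<N. (\<lambda>t. r + N * t) ` Z r)" by (metis UN_iff)
  qed
  have fin: "finite (\<Union>r<N. (\<lambda>t. r + N * t) ` Z r)" using Z by auto
  then show "finite {n. u n = 0}" using subset by (rule rev_finite_subset)
  have "card {n. u n = 0} \<le> card (\<Union>r<N. (\<lambda>t. r + N * t) ` Z r)"
    by (rule card_mono) fact+
  also have "\<dots> \<le> (\<Sum>r<N. card ((\<lambda>t. r + N * t) ` Z r))" by (rule card_UN_le) simp
  also have "\<dots> \<le> (\<Sum>r<N. 2 * N * T\<^sup>2)"
    using Z by (intro sum_mono) (meson card_image_le le_trans lessThan_iff)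
  also have "\<dots> = 2 * T\<^sup>2 * (N * N)" by simp
  also have "\<dots> \<le> 2 * T\<^sup>2 * ((T + 1) ^ (2 * T) * (T + 1) ^ (2 * T))"
    using NT by (intro mult_left_mono mult_mono) auto
  also have "\<dots> = 2 * T\<^sup>2 * (T + 1) ^ (4 * T)" by (simp flip: power_add)
  finally show "card {n. u n = 0} \<le> 2 * T\<^sup>2 * (T + 1) ^ (4 * T)" .
qed

subsection \<open>Counting large zeros\<close>

text \<open>Only the sequence is kept, since its zeros do not depend on the recurrence that presents
  it.\<close>

definition bounded_lrs :: "nat \<Rightarrow> (nat \<Rightarrow> int) set" where
  "bounded_lrs T = {u. \<exists>k a. lrs k a u \<and> nondegenerate u \<and> height k a u \<le> int T}"

lemma lrs_unique:
  assumes "lrs k a u" "lrs k a' u'" "\<And>i. i \<in> {1..k} \<Longrightarrow> a i = a' i" "\<And>i. i < k \<Longrightarrow> u i = u' i"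
  shows "u = u'"
proof
  show "u n = u' n" for n
  proof (induction n rule: less_induct)
    case (less n)
    show ?case
    proof (cases "n < k")
      case False
      then obtain n' where n: "n = n' + k" by (metis add.commute le_Suc_ex not_le)
      have "u n = (\<Sum>i=1..k. a i * u (n - i))" "u' n = (\<Sum>i=1..k. a' i * u' (n - i))"
        using assms(1,2) by (simp_all add: lrs_def n)
      moreover have "(\<Sum>i=1..k. a i * u (n - i)) = (\<Sum>i=1..k. a' i * u' (n - i))"
        using assms(3) less.IH n by (intro sum.cong) auto
      ultimately show ?thesis by simp
    qed (use assms in simp)
  qed
qed

text \<open>After choosing one recurrence per sequence, the lists of its coefficients and initial
  values determine the sequence, the order being the common length. Both lists have length at most T
  and entries in [-T, T].\<close>

lemma card_bounded_lrs:
  "finite (bounded_lrs T)" "card (bounded_lrs T) \<le> (2 * T + 1) ^ (2 * T + 2)"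
proof -
  define L where "L = {xs. set xs \<subseteq> {- int T..int T} \<and> length xs \<le> T}"
  have fin: "finite L" unfolding L_def by (rule finite_lists_length_le) simp
  have "card {- int T..int T} = 2 * T + 1" by simp
  then have "card L = (\<Sum>i\<le>T. (2 * T + 1) ^ i)"
    unfolding L_def by (subst card_lists_length_le) (simp_all only: finite_atLeastAtMost_int)
  also have "\<dots> \<le> (\<Sum>i\<le>T. (2 * T + 1) ^ T)"
    by (intro sum_mono power_increasing) auto
  also have "\<dots> \<le> (2 * T + 1) ^ (T + 1)" by simp
  finally have card_L: "card L \<le> (2 * T + 1) ^ (T + 1)" .
  have "\<exists>k a. lrs k a u \<and> height k a u \<le> int T" if "u \<in> bounded_lrs T" for u
    using that unfolding bounded_lrs_def by blast
  then obtain k a where ka: "\<And>u. u \<in> bounded_lrs T \<Longrightarrow> lrs (k u) (a u) u"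
    "\<And>u. u \<in> bounded_lrs T \<Longrightarrow> height (k u) (a u) u \<le> int T"
    by metis
  define code where "code u = (map (a u) [1..<Suc (k u)], map u [0..<k u])" for u
  have inj: "inj_on code (bounded_lrs T)"
  proof (rule inj_onI)
    fix u v assume uv: "u \<in> bounded_lrs T" "v \<in> bounded_lrs T" "code u = code v"
    then have "map u [0..<k u] = map v [0..<k v]"
      and maps: "map (a u) [1..<Suc (k u)] = map (a v) [1..<Suc (k v)]"
      by (auto simp: code_def)
    then have k: "k u = k v" by (metis length_map length_upt diff_zero)
    show "u = v"
    proof (rule lrs_unique)
      show "lrs (k u) (a u) u" using ka(1) uv(1) .
      show "lrs (k u) (a v) v" unfolding k using ka(1) uv(2) .
      show "a u i = a v i" if "i \<in> {1..k u}" for i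
        using maps that unfolding k by (auto simp: map_eq_conv simp del: upt_Suc)
      show "u i = v i" if "i < k u" for i
        using \<open>map u _ = _\<close> that unfolding k by simp
    qed
  qed
  have sub: "code ` bounded_lrs T \<subseteq> L \<times> L"
  proof
    fix c assume "c \<in> code ` bounded_lrs T"
    then obtain u where u: "u \<in> bounded_lrs T" "c = code u" by blast
    note b = height_bounds[OF ka(2)[OF u(1)]]
    have "x \<in> {- int T..int T}" if "x \<in> a u ` {1..k u} \<union> u ` {..<k u}" for x
      using that b(2,3) by (fastforce simp: abs_le_iff)
    then show "c \<in> L \<times> L"
      using b(1) unfolding u(2) code_def L_def by (auto simp: less_Suc_eq_le)
  qed
  show "finite (bounded_lrs T)"
    using sub fin inj by (meson finite_SigmaI finite_imageD finite_subset)
  have "card (bounded_lrs T) \<le> card (L \<times> L)"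
    using sub fin inj by (intro card_inj_on_le) auto
  also have "\<dots> = card L * card L" by (rule card_cartesian_product)
  also have "\<dots> \<le> (2 * T + 1) ^ (T + 1) * (2 * T + 1) ^ (T + 1)"
    using card_L by (intro mult_mono) auto
  also have "\<dots> = (2 * T + 1) ^ ((T + 1) + (T + 1))" by (simp only: power_add)
  also have "(T + 1) + (T + 1) = 2 * T + 2" by simp
  finally show "card (bounded_lrs T) \<le> (2 * T + 1) ^ (2 * T + 2)" .
qed

lemma card_zeros_bounded_lrs:
  assumes "A \<subseteq> (\<Union>u\<in>bounded_lrs T. {n. u n = 0})"
  shows "card A \<le> (2 * T + 1) ^ (6 * T + 4)"
proof -
  have zeros: "finite {n. u n = 0}" "card {n. u n = 0} \<le> 2 * T\<^sup>2 * (T + 1) ^ (4 * T)"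
    if "u \<in> bounded_lrs T" for u
    using that card_zeros_lrs unfolding bounded_lrs_def by blast+
  have "card A \<le> card (\<Union>u\<in>bounded_lrs T. {n. u n = 0})"
    using assms zeros card_bounded_lrs(1) by (intro card_mono) auto
  also have "\<dots> \<le> (\<Sum>u\<in>bounded_lrs T. card {n. u n = 0})"
    by (rule card_UN_le) (rule card_bounded_lrs)
  also have "\<dots> \<le> card (bounded_lrs T) * (2 * T\<^sup>2 * (T + 1) ^ (4 * T))"
    using sum_bounded_above[OF zeros(2)] by simp
  also have "\<dots> \<le> (2 * T + 1) ^ (2 * T + 2) * ((2 * T + 1)\<^sup>2 * (2 * T + 1) ^ (4 * T))"
  proof (intro mult_mono)
    show "2 * T\<^sup>2 \<le> (2 * T + 1)\<^sup>2" by (simp add: power2_eq_square)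
    show "(T + 1) ^ (4 * T) \<le> (2 * T + 1) ^ (4 * T)" by (intro power_mono) auto
  qed (use card_bounded_lrs(2) in auto)
  also have "\<dots> = (2 * T + 1) ^ (2 * T + 2 + (2 + 4 * T))"
    by (simp only: power_add)
  also have "2 * T + 2 + (2 + 4 * T) = 6 * T + 4" by simp
  finally show ?thesis .
qed

section \<open>Asymptotics of the count\<close>

lemma height_le_ln_ln:
  fixes h :: int
  assumes "exp (exp (10 * h * ln h)) \<le> X" "h \<ge> 1" "X \<ge> exp (exp 1)"
  shows "h \<le> ln (ln X)"
proof -
  have "X > 0" using assms(3) by (meson exp_gt_zero order_less_le_trans)
  then have 1: "exp (10 * h * ln h) \<le> ln X" "exp 1 \<le> ln X"
    using assms(1,3) by (simp_all add: ln_ge_iff)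
  then have "ln X > 0" by (meson exp_gt_zero order_less_le_trans)
  with 1 have 2: "10 * h * ln h \<le> ln (ln X)" "1 \<le> ln (ln X)"
    by (simp_all add: ln_ge_iff)
  \<comment> \<open>For h at least 2, ln h is at least 1 - 1/h and hence at least 1/2, so 10 h ln h
    exceeds h. For h = 1 the exponent is 0, and the claim comes from the lower bound on X
    instead.\<close>
  show ?thesis
  proof (cases "h = 1")
    case False
    with assms(2) have "h \<ge> 2" by linarith
    then have "1 / real_of_int h \<le> 1 / 2" by (simp add: field_simps)
    moreover have "ln (1 / real_of_int h) \<le> 1 / h - 1"
      using \<open>h \<ge> 2\<close> by (intro ln_le_minus_one) simp
    moreover have "ln (1 / real_of_int h) = - ln h"
      using \<open>h \<ge> 2\<close> by (simp add: ln_div)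
    ultimately have "1 \<le> 10 * ln (real_of_int h)" by linarith
    then have "real_of_int h * 1 \<le> h * (10 * ln h)"
      using assms(2) by (intro mult_left_mono) auto
    with 2(1) show ?thesis by (simp add: mult_ac)
  qed (use 2(2) in simp)
qed

lemma count_large_zeros_le:
  assumes "X \<ge> exp (exp 1)"
  shows "real (count_upto large_zeros X) \<le> (2 * ln (ln X) + 1) powr (6 * ln (ln X) + 4)"
proof -
  have "ln X \<ge> exp 1"
    using assms by (meson exp_gt_zero ln_ge_iff order_less_le_trans)
  then have lnln: "ln (ln X) \<ge> 1"
    by (meson exp_gt_zero ln_ge_iff order_less_le_trans)
  define T where "T = nat \<lfloor>ln (ln X)\<rfloor>"
  have T: "real T \<le> ln (ln X)" using lnln by (simp add: T_def)
  have "{n \<in> large_zeros. 1 \<le> real n \<and> real n \<le> X} \<subseteq> (\<Union>u\<in>bounded_lrs T. {n. u n = 0})"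
  proof
    fix n assume n: "n \<in> {n \<in> large_zeros. 1 \<le> real n \<and> real n \<le> X}"
    then obtain k a u where u: "lrs k a u" "nondegenerate u" "u n = 0"
      "exp (exp (10 * real_of_int (height k a u) * ln (real_of_int (height k a u)))) \<le> real n"
      by (auto simp: large_zeros_def)
    have "int k \<le> height k a u" by (rule height_bounds(1)[OF order_refl])
    then have "height k a u \<ge> 1" using u(1) by (simp add: lrs_def)
    from height_le_ln_ln[OF _ this assms] have "real_of_int (height k a u) \<le> ln (ln X)"
      using u(4) n by simp
    then have "height k a u \<le> int T" using lnln by (simp add: T_def le_floor_iff)
    with u show "n \<in> (\<Union>u\<in>bounded_lrs T. {n. u n = 0})"
      by (auto simp: bounded_lrs_def)
  qed
  then have "real (count_upto large_zeros X) \<le> real ((2 * T + 1) ^ (6 * T + 4))"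
    unfolding count_upto_def of_nat_le_iff by (rule card_zeros_bounded_lrs)
  \<comment> \<open>Real exponents allow the integer T to be replaced by ln ln X in base and
    exponent alike.\<close>
  also have "\<dots> = (2 * real T + 1) powr (6 * real T + 4)"
    using powr_realpow[of "2 * real T + 1" "6 * T + 4"] by (simp add: add.commute)
  also have "\<dots> \<le> (2 * ln (ln X) + 1) powr (6 * real T + 4)"
    using T by (intro powr_mono2) auto
  also have "\<dots> \<le> (2 * ln (ln X) + 1) powr (6 * ln (ln X) + 4)"
    using T lnln by (intro powr_mono) auto
  finally show ?thesis .
qed

theorem theorem5p1:
  shows "null_density large_zeros \<and>
    (\<forall>B::real. B > 0 \<longrightarrow>
      (\<lambda>X::real. real (count_upto large_zeros X)) \<in> O[at_top](\<lambda>X. X / (ln X) powr B))"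
proof -
  have count: "(\<lambda>X. real (count_upto large_zeros X)) \<in> O[at_top](\<lambda>X. X / ln X powr B)" for B :: real
  proof -
    have "(\<lambda>X. real (count_upto large_zeros X))
        \<in> O(\<lambda>X. (2 * ln (ln X) + 1) powr (6 * ln (ln X) + 4))"
    proof (rule bigoI)
      show "\<forall>\<^sub>F X in at_top. norm (real (count_upto large_zeros X))
          \<le> 1 * norm ((2 * ln (ln X) + 1) powr (6 * ln (ln X) + 4))"
        using eventually_ge_at_top[of "exp (exp 1)"]
        by eventually_elim (simp add: count_large_zeros_le)
    qed
    \<comment> \<open>The logarithm of the left side is of order ln ln X times ln ln ln X, hence
      o(ln X). The square root of X is a convenient bound between it and X / (ln X)^B for every
      B.\<close>
    also have "(\<lambda>X. (2 * ln (ln X) + 1) powr (6 * ln (ln X) + 4)) \<in> O(\<lambda>X::real. sqrt X)"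
      by real_asymp
    also have "(\<lambda>X::real. sqrt X) \<in> O(\<lambda>X. X / ln X powr B)"
      by real_asymp
    finally show ?thesis .
  qed
  \<comment> \<open>Null density follows from the case B = 1, as 1 / ln X tends to 0.\<close>
  have "(\<lambda>X. real (count_upto large_zeros X) / X) \<in> O(\<lambda>X. (X / ln X powr 1) / X)"
    by (rule landau_o.big.divide_right[OF _ count])
      (rule eventually_mono[OF eventually_gt_at_top[of 0]], simp)
  also have "(\<lambda>X::real. (X / ln X powr 1) / X) \<in> o(\<lambda>_. 1)"
    by real_asymp
  finally have "null_density large_zeros"
    unfolding null_density_def by (rule smalloD_tendsto[where g = "\<lambda>_. 1", simplified])
  with count show ?thesis by blast
qed

end
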